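(* Let $(\Phi,\mathfrak N,\mathfrak T,\mathfrak R,\mathfrak S,\phi_{\mathrm{start}},\Sigma,\mathrm{Lex},\mathrm{Sel})$ be a parameterized local lexing, $D\in\Sigma^*$, $0\le k\le|D|$, $I$ a set of parameterized items and $I'$ a set of ordinary items of the induced grammar. If $I\sim I'$, then $\mathrm{Complete}\,k\,I\sim\mathrm{Complete}'\,k\,I'$.
   Context: $\Phi$ is a non-empty set; $\mathfrak N,\mathfrak T$ disjoint sets of nonterminals and terminals; $\mathfrak S\in\mathfrak N$, $\phi_{\mathrm{start}}\in\Phi$; $\mathfrak R$ a set of parameterized rules $N_{f_{k+1}}\to X_1^{f_1}\cdots X_k^{f_k}$ ($k\ge0$, $N\in\mathfrak N$, $X_i\in\mathfrak N\cup\mathfrak T$, partial $f_i:\Phi^{2i-1}\rightharpoonup\Phi$); $\Sigma,\mathrm{Lex},\mathrm{Sel}$ not needed here. Sequences indexed from 0; juxtaposition is concatenation; $\mathrm{take}_n$ takes the first $n$ entries. $\langle f_1,\dots,f_u\rangle$ is the set of $\rho\in\Phi^{2u}$ with $f_i$ defined at $(\rho_0,\dots,\rho_{2i-2})$ and $\rho_{2i-1}=f_i(\rho_0,\dots,\rho_{2i-2})$ for $i=1,\dots,u$. Induced grammar: nonterminals $(\mathfrak N\times\Phi\times\Phi)\cup\{\top,\bot\}$, terminals $\mathfrak T\times\Phi\times\Phi$, triples written $X^\alpha_\beta$; rules $\overline{\mathfrak R}=\{\top\to\mathfrak S^{\phi_{\mathrm{start}}}_\beta\mid\beta\in\Phi\}\cup\bigcup_{r\in\mathfrak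 R}\overline r$, where for $r=N_{f_{k+1}}\to X_1^{f_1}\cdots X_k^{f_k}$, $\overline r$ consists of (i) rules $N^\alpha_\beta\to(X_1)^{\alpha_1}_{\beta_1}\cdots(X_k)^{\alpha_k}_{\beta_k}$ with $(\alpha,\alpha_1,\beta_1,\dots,\alpha_k,\beta_k,\beta)\in\langle f_1,\dots,f_{k+1}\rangle$, and (ii) rules $N^\alpha_\beta\to(X_1)^{\alpha_1}_{\beta_1}\cdots(X_h)^{\alpha_h}_{\beta_h}\bot$ with $1\le h\le k$, $\beta,\beta_h\in\Phi$, $(\alpha,\alpha_1,\beta_1,\dots,\alpha_h)\in\langle f_1,\dots,f_h\rangle$ and $f_{h+1}$ undefined at $(\alpha,\alpha_1,\beta_1,\dots,\alpha_h,\beta_h)$. Items: parameterized item $(r,d,i,j,\rho)$ with $r=N_{f_{v+1}}\to X_1^{f_1}\cdots X_v^{f_v}\in\mathfrak R$, $0\le d\le v$, $0\le i\le j\le|D|$, $\rho\in\langle f_1,\dots,f_{d+1}\rangle$. Ordinary item $(q,d,i,j)$ with $q=(L\to w)\in\overline{\mathfrak R}$, $0\le d\le|w|$, $0\le i\le j\le|D|$, written $(L\to w_1\bullet w_2,i,j)$, $|w_1|=d$. For $x=(r,d,i,j,\rho)$, $\overline x$ consists of all $(q,d,i,j)$ with $q\in\overline r$ of type (i) and $\mathrm{take}_{2(d+1)}(\alpha,\alpha_1,\beta_1,\dots,\alpha_k,\beta_k,\beta)=\rho$, and all $(q,d,i,j)$ with $q\in\overline r$ of type (ii), $d\le h-1$,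 $\mathrm{take}_{2(d+1)}(\alpha,\alpha_1,\beta_1,\dots,\alpha_h)=\rho$. $\overline I=\bigcup_{x\in I}\overline x$; $\mathrm{Norm}(I')=\{(L\to w_1\bullet w_2,i,j)\in I'\mid L\ne\top,\ w_2\text{ is not the one-symbol string }\bot\}$; $I\sim I'$ means $\overline I=\mathrm{Norm}(I')$. $\mathrm{Complete}\,k\,I=I\cup\{(r,d+1,i,k,\rho'\,f_{d+2}(\rho'))\mid(r,d,i,j,\rho)\in I$ with $r=N_{f_{v+1}}\to X_1^{f_1}\cdots X_v^{f_v}$, $d<v$, $X_{d+1}=M$; $(r',u,j,k,\xi)\in I$ with $r'=M_{g_{u+1}}\to Y_1^{g_1}\cdots Y_u^{g_u}$; $\rho_{2d+1}=\xi_0$; $\rho'=\rho\,\xi_{2u+1}$; $f_{d+2}$ defined at $\rho'\}$. $\mathrm{Complete}'\,k\,I'=I'\cup\{(L\to a\,M\bullet b,i,k)\mid(L\to a\bullet M\,b,i,j)\in I',\ (M\to w\bullet,j,k)\in I'\}$. *)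

theory Defs
  imports Main
begin

text \<open>
  A partial function from powers of the parameter set to the parameter set is a map on lists; its
  arity is imposed by \<open>wf_prule\<close> below.
  A rule \<open>PRule N [(X\<^sub>1, f\<^sub>1), \<dots>, (X\<^sub>k, f\<^sub>k)] f\<close> has \<open>f\<close> as its \<open>f\<^sub>k\<^sub>+\<^sub>1\<close>.
\<close>

type_synonym 'p pfun = "'p list \<rightharpoonup> 'p"

datatype ('s, 'p) prule =
  PRule (lhs: 's) (body: "('s \<times> 'p pfun) list") (out: "'p pfun")

definition syms :: "('s, 'p) prule \<Rightarrow> 's list" where
  "syms r = map fst (body r)"

definition funs :: "('s, 'p) prule \<Rightarrow> 'p pfun list" where
  "funs r = map snd (body r) @ [out r]"

text \<open>Lists are indexed from 0, so \<open>funs r ! i\<close> is \<open>f\<^sub>i\<^sub>+\<^sub>1\<close>, of arity \<open>2 (i + 1) - 1\<close>.\<close>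

definition wf_prule :: "'p set \<Rightarrow> 's set \<Rightarrow> 's set \<Rightarrow> ('s, 'p) prule \<Rightarrow> bool" where
  "wf_prule \<Phi> N T r \<longleftrightarrow>
     lhs r \<in> N \<and> set (syms r) \<subseteq> N \<union> T \<and>
     (\<forall>i < length (funs r).
        dom (funs r ! i) \<subseteq> {xs. length xs = 2 * i + 1 \<and> set xs \<subseteq> \<Phi>} \<and>
        ran (funs r ! i) \<subseteq> \<Phi>)"

text \<open>
  The grammar part of a parameterized local lexing; the lexer and the selector play no role
  for the operators below and are left out.
\<close>

locale parameterized_grammar =
  fixes \<Phi> :: "'p set"
    and N :: "'s set"
    and T :: "'s set"
    and R :: "('s, 'p) prule set"
    and S :: 's
    and \<phi>start :: 'p
  assumes params_nonempty: "\<Phi> \<noteq> {}"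
    and disjoint: "N \<inter> T = {}"
    and start: "S \<in> N"
    and start_param: "\<phi>start \<in> \<Phi>"
    and rules: "\<And>r. r \<in> R \<Longrightarrow> wf_prule \<Phi> N T r"

text \<open>The set \<open>\<langle>f\<^sub>1, \<dots>, f\<^sub>u\<rangle>\<close>.\<close>

definition chains :: "'p set \<Rightarrow> 'p pfun list \<Rightarrow> 'p list set" where
  "chains \<Phi> fs =
     {\<rho>. length \<rho> = 2 * length fs \<and> set \<rho> \<subseteq> \<Phi> \<and>
          (\<forall>i < length fs. (fs ! i) (take (2 * i + 1) \<rho>) = Some (\<rho> ! (2 * i + 1)))}"

text \<open>
  Symbols of the induced grammar: \<open>Sym X \<alpha> \<beta>\<close> is the triple \<open>X\<^sup>\<alpha>\<close> with lower index \<open>\<beta>\<close>,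
  a nonterminal or a terminal according to \<open>X\<close>.
\<close>

datatype ('s, 'p) isym = Top | Bot | Sym 's 'p 'p

type_synonym ('s, 'p) irule = "('s, 'p) isym \<times> ('s, 'p) isym list"

text \<open>
  For \<open>\<tau> = (\<alpha>, \<alpha>\<^sub>1, \<beta>\<^sub>1, \<alpha>\<^sub>2, \<beta>\<^sub>2, \<dots>)\<close>, attach \<open>\<alpha>\<^sub>l\<close> and \<open>\<beta>\<^sub>l\<close> to the \<open>l\<close>-th symbol
  (counted from 1).
\<close>

definition annotate :: "'s list \<Rightarrow> 'p list \<Rightarrow> ('s, 'p) isym list" where
  "annotate Xs \<tau> =
     map (\<lambda>l. Sym (Xs ! l) (\<tau> ! (2 * l + 1)) (\<tau> ! (2 * l + 2))) [0..<length Xs]"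

text \<open>
  Type (i): \<open>\<sigma>\<close> is \<open>(\<alpha>, \<alpha>\<^sub>1, \<beta>\<^sub>1, \<dots>, \<alpha>\<^sub>k, \<beta>\<^sub>k, \<beta>)\<close>.
  Type (ii): \<open>\<sigma>\<close> is \<open>(\<alpha>, \<alpha>\<^sub>1, \<beta>\<^sub>1, \<dots>, \<alpha>\<^sub>h)\<close> and \<open>\<beta>h\<close> is \<open>\<beta>\<^sub>h\<close>.
\<close>

definition full_rule :: "('s, 'p) prule \<Rightarrow> 'p list \<Rightarrow> ('s, 'p) irule" where
  "full_rule r \<sigma> = (Sym (lhs r) (hd \<sigma>) (last \<sigma>), annotate (syms r) \<sigma>)"

definition stuck_rule :: "('s, 'p) prule \<Rightarrow> nat \<Rightarrow> 'p list \<Rightarrow> 'p \<Rightarrow> 'p \<Rightarrow> ('s, 'p) irule" where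
  "stuck_rule r h \<sigma> \<beta>h \<beta> =
     (Sym (lhs r) (hd \<sigma>) \<beta>, annotate (take h (syms r)) (\<sigma> @ [\<beta>h]) @ [Bot])"

definition stuck :: "'p set \<Rightarrow> ('s, 'p) prule \<Rightarrow> nat \<Rightarrow> 'p list \<Rightarrow> 'p \<Rightarrow> 'p \<Rightarrow> bool" where
  "stuck \<Phi> r h \<sigma> \<beta>h \<beta> \<longleftrightarrow>
     1 \<le> h \<and> h \<le> length (syms r) \<and> \<beta> \<in> \<Phi> \<and> \<beta>h \<in> \<Phi> \<and>
     \<sigma> \<in> chains \<Phi> (take h (funs r)) \<and> (funs r ! h) (\<sigma> @ [\<beta>h]) = None"

definition bar_rule :: "'p set \<Rightarrow> ('s, 'p) prule \<Rightarrow> ('s, 'p) irule set" where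
  "bar_rule \<Phi> r =
     {full_rule r \<sigma> | \<sigma>. \<sigma> \<in> chains \<Phi> (funs r)} \<union>
     {stuck_rule r h \<sigma> \<beta>h \<beta> | h \<sigma> \<beta>h \<beta>. stuck \<Phi> r h \<sigma> \<beta>h \<beta>}"

definition induced_rules ::
    "'p set \<Rightarrow> ('s, 'p) prule set \<Rightarrow> 's \<Rightarrow> 'p \<Rightarrow> ('s, 'p) irule set" where
  "induced_rules \<Phi> R S \<phi>start =
     {(Top, [Sym S \<phi>start \<beta>]) | \<beta>. \<beta> \<in> \<Phi>} \<union> (\<Union>r \<in> R. bar_rule \<Phi> r)"

type_synonym ('s, 'p) pitem = "('s, 'p) prule \<times> nat \<times> nat \<times> nat \<times> 'p list"
type_synonym ('s, 'p) item = "('s, 'p) irule \<times> nat \<times> nat \<times> nat"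

definition pitems :: "'p set \<Rightarrow> ('s, 'p) prule set \<Rightarrow> 'c list \<Rightarrow> ('s, 'p) pitem set" where
  "pitems \<Phi> R D =
     {(r, d, i, j, \<rho>). r \<in> R \<and> d \<le> length (syms r) \<and> i \<le> j \<and> j \<le> length D \<and>
        \<rho> \<in> chains \<Phi> (take (d + 1) (funs r))}"

definition items :: "('s, 'p) irule set \<Rightarrow> 'c list \<Rightarrow> ('s, 'p) item set" where
  "items Q D = {((L, w), d, i, j). (L, w) \<in> Q \<and> d \<le> length w \<and> i \<le> j \<and> j \<le> length D}"

fun bar_item :: "'p set \<Rightarrow> ('s, 'p) pitem \<Rightarrow> ('s, 'p) item set" where
  "bar_item \<Phi> (r, d, i, j, \<rho>) =
     {(full_rule r \<sigma>, d, i, j) | \<sigma>. \<sigma> \<in> chains \<Phi> (funs r) \<and> take (2 * (d + 1)) \<sigma> = \<rho>} \<union>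
     {(stuck_rule r h \<sigma> \<beta>h \<beta>, d, i, j) | h \<sigma> \<beta>h \<beta>.
        stuck \<Phi> r h \<sigma> \<beta>h \<beta> \<and> d \<le> h - 1 \<and> take (2 * (d + 1)) \<sigma> = \<rho>}"

definition bar :: "'p set \<Rightarrow> ('s, 'p) pitem set \<Rightarrow> ('s, 'p) item set" where
  "bar \<Phi> I = (\<Union>x \<in> I. bar_item \<Phi> x)"

definition Norm :: "('s, 'p) item set \<Rightarrow> ('s, 'p) item set" where
  "Norm I' = {((L, w), d, i, j) | L w d i j.
     ((L, w), d, i, j) \<in> I' \<and> L \<noteq> Top \<and> drop d w \<noteq> [Bot]}"

definition sim :: "'p set \<Rightarrow> ('s, 'p) pitem set \<Rightarrow> ('s, 'p) item set \<Rightarrow> bool" where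
  "sim \<Phi> I I' \<longleftrightarrow> bar \<Phi> I = Norm I'"

text \<open>The function \<open>f\<^sub>d\<^sub>+\<^sub>2\<close> is \<open>funs r ! (d + 1)\<close>.\<close>

definition Complete :: "nat \<Rightarrow> ('s, 'p) pitem set \<Rightarrow> ('s, 'p) pitem set" where
  "Complete k I = I \<union>
     {(r, d + 1, i, k, \<rho>' @ [y]) | r d i j \<rho> r' u \<xi> \<rho>' y.
        (r, d, i, j, \<rho>) \<in> I \<and> d < length (syms r) \<and>
        (r', u, j, k, \<xi>) \<in> I \<and> u = length (syms r') \<and>
        syms r ! d = lhs r' \<and>
        \<rho> ! (2 * d + 1) = \<xi> ! 0 \<and>
        \<rho>' = \<rho> @ [\<xi> ! (2 * u + 1)] \<and>
        (funs r ! (d + 1)) \<rho>' = Some y}"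

definition Complete' :: "nat \<Rightarrow> ('s, 'p) item set \<Rightarrow> ('s, 'p) item set" where
  "Complete' k I' = I' \<union>
     {((L, a @ [M] @ b), length (a @ [M]), i, k) | L a M b i j w.
        ((L, a @ [M] @ b), length a, i, j) \<in> I' \<and>
        ((M, w), length w, j, k) \<in> I'}"

end

theory Submission
  imports Defs
begin

text \<open>
  The heart of the matter is that advancing the dot of a parameterized item over a symbol with
  output parameter \<open>\<beta>\<close> extends \<open>\<rho>\<close> by \<open>\<beta>\<close> and the value of the next function at \<open>\<rho> \<beta>\<close>. For an induced
  rule containing the advanced position, this value is defined unless the dot now stands directly
  before \<open>\<bottom>\<close>, and those items are exactly the ones discarded by normalization. A finished induced
  item cannot contain \<open>\<bottom>\<close>, since bar items never have their dot behind it, so it comes from a full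
  rule, whose left-hand side carries the first and last parameter of the finished item.
\<close>

section \<open>Lengths and entries of annotations and chains\<close>

lemma length_funs [simp]: "length (funs r) = Suc (length (syms r))"
  by (simp add: funs_def syms_def)

lemma length_annotate [simp]: "length (annotate Xs \<tau>) = length Xs"
  by (simp add: annotate_def)

lemma nth_annotate [simp]:
  "l < length Xs \<Longrightarrow> annotate Xs \<tau> ! l = Sym (Xs ! l) (\<tau> ! (2 * l + 1)) (\<tau> ! (2 * l + 2))"
  by (simp add: annotate_def)

lemma Bot_notin_annotate [simp]: "Bot \<notin> set (annotate Xs \<tau>)"
  by (auto simp: annotate_def)

lemma chains_length: "\<sigma> \<in> chains \<Phi> fs \<Longrightarrow> length \<sigma> = 2 * length fs"
  by (simp add: chains_def)

lemma chains_nth: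
  "\<sigma> \<in> chains \<Phi> fs \<Longrightarrow> i < length fs \<Longrightarrow>
     (fs ! i) (take (2 * i + 1) \<sigma>) = Some (\<sigma> ! (2 * i + 1))"
  by (simp add: chains_def)

lemma take_two_more:
  assumes "n + 1 < length xs"
  shows "take (n + 2) xs = take n xs @ [xs ! n, xs ! (n + 1)]"
  using assms by (simp add: take_Suc_conv_app_nth)

section \<open>Elimination and introduction for bar items\<close>

lemma bar_item_cases:
  assumes "((L, w), d, i, j) \<in> bar_item \<Phi> (r, d', i', j', \<rho>)"
  obtains (full) \<sigma> where "d' = d" "i' = i" "j' = j" "\<sigma> \<in> chains \<Phi> (funs r)"
      "take (2 * d + 2) \<sigma> = \<rho>" "L = Sym (lhs r) (hd \<sigma>) (last \<sigma>)" "w = annotate (syms r) \<sigma>"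
  | (stuck) h \<sigma> \<beta>h \<beta> where "d' = d" "i' = i" "j' = j" "stuck \<Phi> r h \<sigma> \<beta>h \<beta>" "d < h"
      "take (2 * d + 2) \<sigma> = \<rho>" "L = Sym (lhs r) (hd \<sigma>) \<beta>"
      "w = annotate (take h (syms r)) (\<sigma> @ [\<beta>h]) @ [Bot]"
proof -
  from assms consider
    \<sigma> where "(L, w) = full_rule r \<sigma>" "d' = d" "i' = i" "j' = j" "\<sigma> \<in> chains \<Phi> (funs r)"
      "take (2 * d + 2) \<sigma> = \<rho>"
  | h \<sigma> \<beta>h \<beta> where "(L, w) = stuck_rule r h \<sigma> \<beta>h \<beta>" "d' = d" "i' = i" "j' = j"
      "stuck \<Phi> r h \<sigma> \<beta>h \<beta>" "d \<le> h - 1" "take (2 * d + 2) \<sigma> = \<rho>"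
    by auto
  then show thesis
  proof cases
    case 1
    then show ?thesis by (intro full) (auto simp: full_rule_def)
  next
    case 2
    from 2(5) have "1 \<le> h" by (simp add: stuck_def)
    with 2 show ?thesis by (intro stuck) (auto simp: stuck_rule_def)
  qed
qed

lemma bar_item_fullI:
  assumes "\<sigma> \<in> chains \<Phi> (funs r)" "take (2 * d + 2) \<sigma> = \<rho>"
  shows "((Sym (lhs r) (hd \<sigma>) (last \<sigma>), annotate (syms r) \<sigma>), d, i, j)
    \<in> bar_item \<Phi> (r, d, i, j, \<rho>)"
  using assms by (auto simp: full_rule_def)

lemma bar_item_stuckI:
  assumes "stuck \<Phi> r h \<sigma> \<beta>h \<beta>" "d < h" "take (2 * d + 2) \<sigma> = \<rho>"
  shows "((Sym (lhs r) (hd \<sigma>) \<beta>, annotate (take h (syms r)) (\<sigma> @ [\<beta>h]) @ [Bot]), d, i, j)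
    \<in> bar_item \<Phi> (r, d, i, j, \<rho>)"
proof -
  have "d \<le> h - 1" using assms(2) by simp
  with assms show ?thesis by (fastforce simp: stuck_rule_def)
qed

section \<open>Moving the dot over one symbol\<close>

declare bar_item.simps [simp del]

text \<open>The chain \<sigma> behind the rule extends \<rho>, so \<beta> and \<open>y\<close> can
  be read off as its next two entries, and the chain condition at index \<open>d + 1\<close> says
  that the next function sends \<open>\<rho> @ [\<beta>]\<close> to \<open>y\<close>. Only a stuck
  rule with \<open>d + 1 = h\<close> has no such entries. The new end \<open>k\<close> is free
  because the rule and the chain do not depend on positions.\<close>

lemma bar_item_advance:
  assumes item: "((L, w), d, i, j) \<in> bar_item \<Phi> (r, d, i, j, \<rho>)"
    and "d < length w"
  obtains \<beta> where "d < length (syms r)" "w ! d = Sym (syms r ! d) (\<rho> ! (2 * d + 1)) \<beta>"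
    "drop (d + 1) w = [Bot] \<or>
     (\<exists>y. (funs r ! (d + 1)) (\<rho> @ [\<beta>]) = Some y \<and>
          ((L, w), d + 1, i, k) \<in> bar_item \<Phi> (r, d + 1, i, k, \<rho> @ [\<beta>, y]))"
  using item
proof (cases rule: bar_item_cases)
  case (full \<sigma>)
  have d: "d < length (syms r)" using \<open>d < length w\<close> full by simp
  have len: "length \<sigma> = 2 * length (syms r) + 2" using chains_length[OF full(4)] by simp
  have ext: "take (2 * (d + 1) + 2) \<sigma> = \<rho> @ [\<sigma> ! (2 * d + 2), \<sigma> ! (2 * d + 3)]"
    using take_two_more[of "2 * d + 2" \<sigma>] d len full(5) by (simp add: eval_nat_numeral)
  \<comment> \<open>This prefix of odd length is the argument list in the chain condition for
    \<open>funs r ! (d + 1)\<close>.\<close>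
  have pre: "take (2 * (d + 1) + 1) \<sigma> = \<rho> @ [\<sigma> ! (2 * d + 2)]"
    using d len full(5) by (auto simp: take_Suc_conv_app_nth)
  have "(funs r ! (d + 1)) (\<rho> @ [\<sigma> ! (2 * d + 2)]) = Some (\<sigma> ! (2 * d + 3))"
    using chains_nth[OF full(4), of "d + 1"] d unfolding pre by (simp add: eval_nat_numeral)
  moreover have "((L, w), d + 1, i, k) \<in>
      bar_item \<Phi> (r, d + 1, i, k, \<rho> @ [\<sigma> ! (2 * d + 2), \<sigma> ! (2 * d + 3)])"
    using bar_item_fullI[OF full(4) ext] full(6,7) by simp
  moreover have "w ! d = Sym (syms r ! d) (\<rho> ! (2 * d + 1)) (\<sigma> ! (2 * d + 2))"
    using d full(5,7) by auto
  ultimately show ?thesis using that d by blast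
next
  case (stuck h \<sigma> \<beta>h \<beta>)
  let ?\<tau> = "\<sigma> @ [\<beta>h]"
  have h: "h \<le> length (syms r)" and \<sigma>: "\<sigma> \<in> chains \<Phi> (take h (funs r))"
    using stuck(4) by (auto simp: stuck_def)
  have d: "d < length (syms r)" using stuck(5) h by simp
  have len: "length \<sigma> = 2 * h" using chains_length[OF \<sigma>] h by simp
  have sym: "w ! d = Sym (syms r ! d) (\<rho> ! (2 * d + 1)) (?\<tau> ! (2 * d + 2))"
    using stuck(5,6,8) h len by (auto simp: nth_append)
  show ?thesis
  \<comment> \<open>For \<open>d + 1 = h\<close> the passed symbol carries \<open>\<beta>h\<close>,
    which lies outside \<sigma>, and only \<open>Bot\<close> remains; otherwise its \<beta> is an
    entry of \<sigma> and the argument for full rules applies.\<close>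
  proof (cases "d + 1 = h")
    case True
    then have "drop (d + 1) w = [Bot]" using stuck(8) h by simp
    then show ?thesis using that d sym by blast
  next
    case False
    then have dh: "d + 1 < h" using stuck(5) by simp
    have \<beta>: "?\<tau> ! (2 * d + 2) = \<sigma> ! (2 * d + 2)" using dh len by (simp add: nth_append)
    have ext: "take (2 * (d + 1) + 2) \<sigma> = \<rho> @ [\<sigma> ! (2 * d + 2), \<sigma> ! (2 * d + 3)]"
      using take_two_more[of "2 * d + 2" \<sigma>] dh len stuck(6) by (simp add: eval_nat_numeral)
    have pre: "take (2 * (d + 1) + 1) \<sigma> = \<rho> @ [\<sigma> ! (2 * d + 2)]"
      using dh len stuck(6) by (auto simp: take_Suc_conv_app_nth)
    have "(funs r ! (d + 1)) (\<rho> @ [\<sigma> ! (2 * d + 2)]) = Some (\<sigma> ! (2 * d + 3))"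
      using chains_nth[OF \<sigma>, of "d + 1"] dh h unfolding pre by (simp add: eval_nat_numeral)
    moreover have "((L, w), d + 1, i, k) \<in>
        bar_item \<Phi> (r, d + 1, i, k, \<rho> @ [\<sigma> ! (2 * d + 2), \<sigma> ! (2 * d + 3)])"
      using bar_item_stuckI[OF stuck(4) dh ext] stuck(7,8) by simp
    ultimately show ?thesis using that d sym unfolding \<beta> by blast
  qed
qed

text \<open>A chain that begins with \<rho>, \<beta>, \<open>y\<close> also begins with \<rho>, so
  the same rule serves with the dot one place earlier and with any end \<open>j\<close>. The length
  of \<rho> fixes \<beta> as entry \<open>2 * d + 2\<close>, the lower index of the passed
  symbol.\<close>

lemma bar_item_retreat:
  assumes item: "((L, w), d', i', k') \<in> bar_item \<Phi> (r, d + 1, i, k, \<rho> @ [\<beta>, y])"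
    and len\<rho>: "length \<rho> = 2 * d + 2" and d: "d < length (syms r)"
  shows "((L, w), d, i, j) \<in> bar_item \<Phi> (r, d, i, j, \<rho>)"
    and "d' = d + 1" "i' = i" "k' = k" "d < length w"
    and "w ! d = Sym (syms r ! d) (\<rho> ! (2 * d + 1)) \<beta>"
proof -
  have *: "take (2 * d + 2) \<sigma> = \<rho> \<and> \<sigma> ! (2 * d + 1) = \<rho> ! (2 * d + 1) \<and> \<sigma> ! (2 * d + 2) = \<beta>"
    if "take (2 * (d + 1) + 2) \<sigma> = \<rho> @ [\<beta>, y]" for \<sigma>
  proof -
    have "take (2 * d + 2) (take (2 * (d + 1) + 2) \<sigma>) = \<rho>" unfolding that using len\<rho> by simp
    moreover have "take (2 * (d + 1) + 2) \<sigma> ! (2 * d + 1) = \<rho> ! (2 * d + 1)"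
      "take (2 * (d + 1) + 2) \<sigma> ! (2 * d + 2) = \<beta>"
      unfolding that using len\<rho> by (simp_all add: nth_append)
    ultimately show ?thesis by (simp add: min_def)
  qed
  from item have "((L, w), d, i, j) \<in> bar_item \<Phi> (r, d, i, j, \<rho>) \<and> d' = d + 1 \<and> i' = i \<and> k' = k \<and>
    d < length w \<and> w ! d = Sym (syms r ! d) (\<rho> ! (2 * d + 1)) \<beta>"
  proof (cases rule: bar_item_cases)
    case (full \<sigma>)
    note \<sigma> = *[OF full(5)[folded full(1)]]
    show ?thesis using bar_item_fullI[OF full(4), of d \<rho>] \<sigma> full(1-3,6,7) d by simp
  next
    case (stuck h \<sigma> \<beta>h \<beta>')
    note \<sigma> = *[OF stuck(6)[folded stuck(1)]]
    have dh: "d + 1 < h" using stuck(1,5) by simp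
    have h: "h \<le> length (syms r)" using stuck(4) by (simp add: stuck_def)
    have "length \<sigma> = 2 * h" using stuck(4) chains_length h by (fastforce simp: stuck_def)
    then show ?thesis
      using bar_item_stuckI[OF stuck(4), of d \<rho>] \<sigma> stuck(1-3,7,8) dh h by (simp add: nth_append)
  qed
  then show "((L, w), d, i, j) \<in> bar_item \<Phi> (r, d, i, j, \<rho>)" "d' = d + 1" "i' = i" "k' = k"
    "d < length w" "w ! d = Sym (syms r ! d) (\<rho> ! (2 * d + 1)) \<beta>" by auto
qed

section \<open>Finished items and normal form\<close>

lemma finished_bar_item:
  assumes "((M, w), length w, j, k) \<in> bar_item \<Phi> (r, u, j', k', \<xi>)"
  shows "u = length (syms r)" "j' = j" "k' = k"
    and "M = Sym (lhs r) (\<xi> ! 0) (\<xi> ! (2 * u + 1))"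
proof -
  from assms have "u = length (syms r) \<and> j' = j \<and> k' = k \<and>
    M = Sym (lhs r) (\<xi> ! 0) (\<xi> ! (2 * u + 1))"
  proof (cases rule: bar_item_cases)
    case (full \<sigma>)
    have len: "length \<sigma> = 2 * length (syms r) + 2" using chains_length[OF full(4)] by simp
    \<comment> \<open>With the dot at the end, the prefix of length \<open>2 * length w + 2\<close>
      is all of \<sigma>.\<close>
    then have "\<sigma> \<noteq> []" "\<xi> = \<sigma>" using full(5,7) by auto
    then show ?thesis using len full by (simp add: hd_conv_nth last_conv_nth)
  next
    case (stuck h \<sigma> \<beta>h \<beta>)
    \<comment> \<open>Impossible: here \<open>w\<close> has length \<open>h + 1\<close>, while the
      dot position is below \<open>h\<close>.\<close>
    then show ?thesis by (simp add: stuck_def)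
  qed
  then show "u = length (syms r)" "j' = j" "k' = k"
    "M = Sym (lhs r) (\<xi> ! 0) (\<xi> ! (2 * u + 1))" by auto
qed

text \<open>Supplies the completed rule that \<open>Complete'\<close> needs: \<xi> is already a
  whole chain, so it annotates the right-hand side itself.\<close>

lemma finished_bar_itemI:
  assumes "\<xi> \<in> chains \<Phi> (funs r)" "u = length (syms r)"
  shows "((Sym (lhs r) (\<xi> ! 0) (\<xi> ! (2 * u + 1)), annotate (syms r) \<xi>), u, j, k)
    \<in> bar_item \<Phi> (r, u, j, k, \<xi>)"
proof -
  have len: "length \<xi> = 2 * u + 2" using chains_length[OF assms(1)] assms(2) by simp
  then have "\<xi> \<noteq> []" by auto
  with len have "hd \<xi> = \<xi> ! 0" "last \<xi> = \<xi> ! (2 * u + 1)"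
    by (simp_all add: hd_conv_nth last_conv_nth)
  then show ?thesis using bar_item_fullI[OF assms(1), of u \<xi>] len by simp
qed

lemma bar_item_normal:
  assumes "((L, w), d, i, j) \<in> bar_item \<Phi> x"
  shows "L \<noteq> Top" "drop d w \<noteq> [Bot]"
proof -
  obtain r d' i' j' \<rho> where x: "x = (r, d', i', j', \<rho>)" by (cases x)
  from assms[unfolded x] have "L \<noteq> Top \<and> drop d w \<noteq> [Bot]"
  proof (cases rule: bar_item_cases)
    case (full \<sigma>)
    have "Bot \<notin> set (drop d w)" unfolding full(7) using Bot_notin_annotate in_set_dropD by fast
    then show ?thesis using full(6) by auto
  next
    case (stuck h \<sigma> \<beta>h \<beta>)
    \<comment> \<open>As \<open>d < h\<close>, an annotated symbol still stands between the dot and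
      \<open>Bot\<close>.\<close>
    then show ?thesis by (auto simp: stuck_def)
  qed
  then show "L \<noteq> Top" "drop d w \<noteq> [Bot]" by auto
qed

section \<open>Membership in \<open>Norm\<close> and \<open>Complete'\<close>\<close>

lemma mem_Norm:
  "((L, w), d, i, j) \<in> Norm I' \<longleftrightarrow> ((L, w), d, i, j) \<in> I' \<and> L \<noteq> Top \<and> drop d w \<noteq> [Bot]"
  by (auto simp: Norm_def)

lemma induced_rules_lhs: "(L, w) \<in> induced_rules \<Phi> R S \<phi>start \<Longrightarrow> L \<noteq> Bot"
  by (auto simp: induced_rules_def bar_rule_def full_rule_def stuck_rule_def)

text \<open>Replaces the splitting \<open>a @ [M] @ b\<close> by the index
  \<open>e = length a\<close>, which matches the indexing of parameterized items.\<close>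

lemma mem_Complete':
  "((L, w), d, i, k') \<in> Complete' k I' \<longleftrightarrow> ((L, w), d, i, k') \<in> I' \<or>
     (k' = k \<and> (\<exists>e j v. d = e + 1 \<and> e < length w \<and> ((L, w), e, i, j) \<in> I' \<and>
        ((w ! e, v), length v, j, k) \<in> I'))"
  (is "_ \<longleftrightarrow> _ \<or> ?new")
proof -
  have "?new \<longleftrightarrow> (\<exists>a M b j v. w = a @ [M] @ b \<and> d = length (a @ [M]) \<and> k' = k \<and>
      ((L, a @ [M] @ b), length a, i, j) \<in> I' \<and> ((M, v), length v, j, k) \<in> I')"
    (is "_ \<longleftrightarrow> ?split")
  proof
    assume ?new
    then obtain e j v where e: "k' = k" "d = e + 1" "e < length w" "((L, w), e, i, j) \<in> I'"
      "((w ! e, v), length v, j, k) \<in> I'" by auto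
    have "w = take e w @ [w ! e] @ drop (Suc e) w" using e(3) by (simp add: id_take_nth_drop)
    moreover have "d = length (take e w @ [w ! e])" "length (take e w) = e" using e by simp_all
    ultimately show ?split using e by metis
  next
    assume ?split
    then show ?new by (fastforce simp: nth_append)
  qed
  then show ?thesis unfolding Complete'_def by blast
qed

section \<open>Completion preserves the simulation\<close>

theorem theorem7:
  fixes \<Phi> :: "'p set" and N T :: "'s set" and R :: "('s, 'p) prule set"
    and S :: 's and \<phi>start :: 'p and \<Sigma> :: "'c set" and D :: "'c list" and k :: nat
    and I :: "('s, 'p) pitem set" and I' :: "('s, 'p) item set"
  assumes "parameterized_grammar \<Phi> N T R S \<phi>start"
    and "D \<in> lists \<Sigma>"
    and "k \<le> length D"
    and "I \<subseteq> pitems \<Phi> R D"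
    and "I' \<subseteq> items (induced_rules \<Phi> R S \<phi>start) D"
    and "sim \<Phi> I I'"
  shows "sim \<Phi> (Complete k I) (Complete' k I')"
proof -
  have bar: "bar \<Phi> I = Norm I'" using assms(6) by (simp add: sim_def)
  have barI: "q \<in> I'" if "x \<in> I" "q \<in> bar_item \<Phi> x" for x q
  proof -
    have "q \<in> Norm I'" using that unfolding bar[symmetric] by (auto simp: bar_def)
    then show ?thesis by (auto simp: Norm_def)
  qed
  have barE: "\<exists>r \<rho>. (r, d, i, j, \<rho>) \<in> I \<and> ((L, w), d, i, j) \<in> bar_item \<Phi> (r, d, i, j, \<rho>)"
    if q: "((L, w), d, i, j) \<in> I'" "L \<noteq> Top" "drop d w \<noteq> [Bot]" for L w d i j
  proof -
    have "((L, w), d, i, j) \<in> bar \<Phi> I" using q by (simp add: bar mem_Norm)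
    then obtain r d' i' j' \<rho> where x: "(r, d', i', j', \<rho>) \<in> I"
      "((L, w), d, i, j) \<in> bar_item \<Phi> (r, d', i', j', \<rho>)"
      unfolding bar_def by (metis UN_E prod_cases5)
    from x(2) have "d' = d" "i' = i" "j' = j" by (auto elim: bar_item_cases)
    with x show ?thesis by blast
  qed
  have "((L, w), d, i, j) \<in> bar \<Phi> (Complete k I) \<longleftrightarrow>
      ((L, w), d, i, j) \<in> Norm (Complete' k I')" (is "?l \<longleftrightarrow> ?r") for L w d i j
  proof
    assume ?l
    then obtain x where x: "x \<in> Complete k I" "((L, w), d, i, j) \<in> bar_item \<Phi> x"
      by (auto simp only: bar_def)
    have "((L, w), d, i, j) \<in> Complete' k I'"
    proof (cases "x \<in> I")
      case True
      then show ?thesis using barI x(2) by (simp add: mem_Complete')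
    next
      case False
      with x(1) obtain r e i0 j0 \<rho> r' u \<xi> y where
        x_eq: "x = (r, e + 1, i0, k, \<rho> @ [\<xi> ! (2 * u + 1), y])"
        and p: "(r, e, i0, j0, \<rho>) \<in> I" "e < length (syms r)"
        and p': "(r', u, j0, k, \<xi>) \<in> I" "u = length (syms r')"
        and match: "syms r ! e = lhs r'" "\<rho> ! (2 * e + 1) = \<xi> ! 0"
        unfolding Complete_def by auto
      \<comment> \<open>Being items fixes the length of \<rho>; for the finished item,
        \<open>u + 1\<close> is the number of functions of \<open>r'\<close>, so \<xi> is a chain
        for all of them.\<close>
      have "\<rho> \<in> chains \<Phi> (take (e + 1) (funs r))" "\<xi> \<in> chains \<Phi> (take (u + 1) (funs r'))"
        using p(1) p'(1) assms(4) by (auto simp: pitems_def)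
      then have len: "length \<rho> = 2 * e + 2" and \<xi>: "\<xi> \<in> chains \<Phi> (funs r')"
        using p(2) p'(2) by (auto dest: chains_length)
      note ret = bar_item_retreat[OF x(2)[unfolded x_eq] len p(2)]
      have "((L, w), e, i0, j0) \<in> I'" using barI[OF p(1)] ret(1) by blast
      moreover have "((w ! e, annotate (syms r') \<xi>), length (annotate (syms r') \<xi>), j0, k) \<in> I'"
        using barI[OF p'(1) finished_bar_itemI[OF \<xi> p'(2)]] ret(6) match p'(2) by simp
      ultimately show ?thesis using ret(2-5) unfolding mem_Complete' by blast
    qed
    then show ?r using bar_item_normal[OF x(2)] by (simp add: mem_Norm)
  next
    assume ?r
    then have q: "((L, w), d, i, j) \<in> Complete' k I'" and L: "L \<noteq> Top" and w: "drop d w \<noteq> [Bot]"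
      by (auto simp: mem_Norm)
    show ?l
    proof (cases "((L, w), d, i, j) \<in> I'")
      case True
      from barE[OF this L w] show ?thesis unfolding bar_def Complete_def by blast
    next
      case False
      with q obtain e j0 v where j: "j = k" and d: "d = e + 1" and e: "e < length w"
        and q1: "((L, w), e, i, j0) \<in> I'" and q2: "((w ! e, v), length v, j0, k) \<in> I'"
        unfolding mem_Complete' by blast
      have "(w ! e, v) \<in> induced_rules \<Phi> R S \<phi>start" using q2 assms(5) by (auto simp: items_def)
      then have "w ! e \<noteq> Bot" by (rule induced_rules_lhs)
      \<comment> \<open>Hence the item before completion survives normalization and comes from a
        parameterized item.\<close>
      then have "drop e w \<noteq> [Bot]" using e by (metis hd_drop_conv_nth list.sel(1))
      from barE[OF q1 L this] obtain r \<rho> where p: "(r, e, i, j0, \<rho>) \<in> I"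
        and b1: "((L, w), e, i, j0) \<in> bar_item \<Phi> (r, e, i, j0, \<rho>)" by blast
      \<comment> \<open>The alternative \<open>[Bot]\<close> in \<open>bar_item_advance\<close> is
        excluded because the advanced item is normal.\<close>
      obtain \<beta> y where er: "e < length (syms r)"
        and M: "w ! e = Sym (syms r ! e) (\<rho> ! (2 * e + 1)) \<beta>"
        and y: "(funs r ! (e + 1)) (\<rho> @ [\<beta>]) = Some y"
        and b: "((L, w), e + 1, i, k) \<in> bar_item \<Phi> (r, e + 1, i, k, \<rho> @ [\<beta>, y])"
        using bar_item_advance[OF b1 e, of k] w d by blast
      have "w ! e \<noteq> Top" using M by simp
      then obtain r' \<xi> where p': "(r', length v, j0, k, \<xi>) \<in> I"
        and b2: "((w ! e, v), length v, j0, k) \<in> bar_item \<Phi> (r', length v, j0, k, \<xi>)"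
        using barE[OF q2] by auto
      note fin = finished_bar_item[OF b2]
      \<comment> \<open>Comparing \<open>M\<close> with \<open>fin(4)\<close> gives all matching
        conditions at once: equal symbols, equal input parameters, and \<beta> as the last entry of
        \<xi>.\<close>
      have "(r, e + 1, i, k, (\<rho> @ [\<beta>]) @ [y]) \<in> Complete k I"
        unfolding Complete_def using p p' er y fin(1,4) M by fastforce
      then show ?thesis using b unfolding bar_def d j by auto
    qed
  qed
  then have "q \<in> bar \<Phi> (Complete k I) \<longleftrightarrow> q \<in> Norm (Complete' k I')" for q
    by (metis surj_pair)
  then show ?thesis unfolding sim_def by blast
qed

end
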